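(* Let $n\ge1$ and let $\vec x=(x_1,\dots,x_n)$, $\vec y=(y_1,\dots,y_n)$ be vectors in $\mathbb C^n$. Then the rotational deviation of $\vec x$ from $\vec y$ is $$d(\mathbb T\vec x,\vec y)=\sqrt{\|\vec x\|^2+\|\vec y\|^2-2\,|\langle\vec x|\vec y\rangle|}=d(a\vec x,\vec y),$$ where $a=\dfrac{\overline{\langle\vec x|\vec y\rangle}}{|\langle\vec x|\vec y\rangle|}$ if $\langle\vec x|\vec y\rangle\ne0$, and $a$ is any element of $\mathbb T$ if $\langle\vec x|\vec y\rangle=0$.
   Context: $\mathbb T=\{z\in\mathbb C:|z|=1\}$. For $\vec x,\vec y\in\mathbb C^n$: $\langle\vec x|\vec y\rangle=\sum_{k=1}^nx_k\overline{y_k}$, $\|\vec x\|=\sqrt{\langle\vec x|\vec x\rangle}$, $d(\vec x,\vec y)=\|\vec x-\vec y\|=\big(\sum_{k=1}^n|x_k-y_k|^2\big)^{1/2}$. The rotational deviation is $d(\mathbb T\vec x,\vec y)=\inf\{d(a\vec x,\vec y):a\in\mathbb T\}$. *)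

theory Defs
  imports "HOL-Analysis.Analysis"
begin

text \<open>
  Vectors in \<open>\<complex>\<^sup>n\<close> are elements of \<^typ>\<open>complex ^ 'n\<close>, and \<open>\<parallel>x\<parallel>\<close>, \<open>d\<close> are the library's
  \<^const>\<open>norm\<close> and \<^const>\<open>dist\<close> on that type; the two lemmas below confirm that these
  are the Euclidean norm and distance induced by the Hermitian product. The library's
  \<^const>\<open>inner\<close> is the real part of that product, so the product itself is defined here,
  conjugate-linear in the second argument.
\<close>

definition hermitian :: "complex ^ 'n \<Rightarrow> complex ^ 'n \<Rightarrow> complex"
  where "hermitian x y = (\<Sum>k\<in>UNIV. x $ k * cnj (y $ k))"

definition unit_circle :: "complex set"
  where "unit_circle = {z. cmod z = 1}"

definition rotational_deviation :: "complex ^ 'n \<Rightarrow> complex ^ 'n \<Rightarrow> real"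
  where "rotational_deviation x y = Inf {dist (a *s x) y | a. a \<in> unit_circle}"

lemma norm_eq_sqrt_hermitian:
  fixes x :: "complex ^ 'n"
  shows "complex_of_real ((norm x)\<^sup>2) = hermitian x x"
    and "norm x = sqrt (Re (hermitian x x))"
proof -
  have sq: "(norm x)\<^sup>2 = (\<Sum>k\<in>UNIV. (cmod (x $ k))\<^sup>2)"
    by (simp add: norm_vec_def L2_set_def sum_nonneg)
  show eq: "complex_of_real ((norm x)\<^sup>2) = hermitian x x"
    unfolding sq hermitian_def of_real_sum by (intro sum.cong refl complex_norm_square)
  show "norm x = sqrt (Re (hermitian x x))"
    unfolding eq[symmetric] by simp
qed

lemma dist_eq_sqrt_sum:
  fixes x y :: "complex ^ 'n"
  shows "dist x y = sqrt (\<Sum>k\<in>UNIV. (cmod (x $ k - y $ k))\<^sup>2)"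
  by (simp add: dist_vec_def L2_set_def dist_norm)

end

theory Submission
  imports Defs
begin

text \<open>
  Multiplication by a unimodular \<open>a\<close> preserves the norm, so expanding the square gives
  \<open>d(a x, y)\<^sup>2 = \<parallel>x\<parallel>\<^sup>2 + \<parallel>y\<parallel>\<^sup>2 - 2 Re (a \<langle>x|y\<rangle>)\<close>, in which only the last term depends
  on \<open>a\<close> (\<open>dist_unit_circle_scale\<close>). As \<open>Re (a \<langle>x|y\<rangle>) \<le> |a \<langle>x|y\<rangle>| = |\<langle>x|y\<rangle>|\<close>, every rotation
  is at distance at least the claimed value from \<open>y\<close>. Equality holds exactly when \<open>a\<close> turns
  \<open>\<langle>x|y\<rangle>\<close> into a nonnegative real, which the stated \<open>a\<close> does; the infimum is therefore
  a minimum, with this value.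
\<close>

lemma cmod_diff_squared_unit_circle:
  assumes "a \<in> unit_circle"
  shows "(cmod (a * u - v))\<^sup>2 = (cmod u)\<^sup>2 + (cmod v)\<^sup>2 - 2 * Re (a * (u * cnj v))"
proof -
  have "(cmod (a * u - v))\<^sup>2 = (cmod (a * u))\<^sup>2 + (cmod v)\<^sup>2 - 2 * Re (a * u * cnj v)"
    unfolding cmod_power2 by (simp add: power2_eq_square algebra_simps)
  moreover have "cmod (a * u) = cmod u"
    using assms by (simp add: unit_circle_def norm_mult)
  ultimately show ?thesis
    by (simp add: mult.assoc)
qed

lemma dist_unit_circle_scale:
  fixes x y :: "complex ^ 'n"
  assumes "a \<in> unit_circle"
  shows "dist (a *s x) y = sqrt ((norm x)\<^sup>2 + (norm y)\<^sup>2 - 2 * Re (a * hermitian x y))"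
proof -
  have norm_squared: "(norm v)\<^sup>2 = (\<Sum>k\<in>UNIV. (cmod (v $ k))\<^sup>2)" for v :: "complex ^ 'n"
    by (simp add: norm_vec_def L2_set_def sum_nonneg)
  have "(\<Sum>k\<in>UNIV. (cmod ((a *s x) $ k - y $ k))\<^sup>2)
      = (\<Sum>k\<in>UNIV. (cmod (x $ k))\<^sup>2 + (cmod (y $ k))\<^sup>2 - 2 * Re (a * (x $ k * cnj (y $ k))))"
    by (simp only: vector_smult_component cmod_diff_squared_unit_circle[OF assms])
  also have "\<dots> = (norm x)\<^sup>2 + (norm y)\<^sup>2 - 2 * Re (a * hermitian x y)"
    by (simp only: norm_squared hermitian_def sum_subtractf sum.distrib sum_distrib_left Re_sum)
  finally show ?thesis
    by (simp only: dist_eq_sqrt_sum)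
qed

lemma dist_unit_circle_scale_ge:
  fixes x y :: "complex ^ 'n"
  assumes "a \<in> unit_circle"
  shows "sqrt ((norm x)\<^sup>2 + (norm y)\<^sup>2 - 2 * cmod (hermitian x y)) \<le> dist (a *s x) y"
proof -
  have "Re (a * hermitian x y) \<le> cmod (a * hermitian x y)"
    by (rule complex_Re_le_cmod)
  also have "\<dots> = cmod (hermitian x y)"
    using assms by (simp add: unit_circle_def norm_mult)
  finally show ?thesis
    by (simp add: dist_unit_circle_scale[OF assms])
qed

theorem theorem1:
  fixes x y :: "complex ^ 'n"
  shows "rotational_deviation x y
           = sqrt ((norm x)\<^sup>2 + (norm y)\<^sup>2 - 2 * cmod (hermitian x y))
       \<and> (\<forall>a. (if hermitian x y \<noteq> 0
                then a = cnj (hermitian x y) / complex_of_real (cmod (hermitian x y))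
                else a \<in> unit_circle)
             \<longrightarrow> sqrt ((norm x)\<^sup>2 + (norm y)\<^sup>2 - 2 * cmod (hermitian x y)) = dist (a *s x) y)"
proof -
  define h where "h = hermitian x y"
  define m where "m = sqrt ((norm x)\<^sup>2 + (norm y)\<^sup>2 - 2 * cmod h)"
  define optimal where
    "optimal a \<longleftrightarrow> (if h \<noteq> 0 then a = cnj h / complex_of_real (cmod h) else a \<in> unit_circle)" for a
  have attained: "a \<in> unit_circle \<and> dist (a *s x) y = m" if "optimal a" for a
  proof -
    have unimodular: "a \<in> unit_circle"
      using that by (auto simp: optimal_def unit_circle_def norm_divide split: if_splits)
    have "a * h = complex_of_real (cmod h)"
    proof (cases "h = 0")
      case False
      then have "a * h = h * cnj h / complex_of_real (cmod h)"
        using that by (simp add: optimal_def)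
      also have "\<dots> = complex_of_real (cmod h)"
        using False by (simp add: complex_norm_square[symmetric] power2_eq_square)
      finally show ?thesis .
    qed simp
    then show ?thesis
      using unimodular by (simp add: dist_unit_circle_scale m_def flip: h_def)
  qed
  obtain a where "optimal a"
  proof (cases "h = 0")
    case True
    then have "optimal 1"
      by (simp add: optimal_def unit_circle_def)
    then show thesis by (rule that)
  next
    case False
    then have "optimal (cnj h / complex_of_real (cmod h))"
      by (simp add: optimal_def)
    then show thesis by (rule that)
  qed
  then have "m \<in> {dist (a *s x) y | a. a \<in> unit_circle}"
    using attained by force
  then have "rotational_deviation x y = m"
    unfolding rotational_deviation_def
    by (rule cInf_eq_minimum) (auto simp: m_def h_def intro: dist_unit_circle_scale_ge)
  then show ?thesis
    using attained unfolding optimal_def m_def h_def by metis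
qed

end
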